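(* Let $A \in \mathbb{R}^{n \times n}$ be a nonzero matrix of rank $r$ with $\mathcal{R}(A) = \mathcal{R}(A^{\mathsf{T}})$. Let $\boldsymbol{b}, \boldsymbol{x}_0 \in \mathbb{R}^n$, $\boldsymbol{r}_0 = \boldsymbol{b} - A\boldsymbol{x}_0$, and let $k \geq 1$ be such that $\dim \mathcal{K}_k(A,A\boldsymbol{r}_0) = k$. Then the extended Hessenberg matrix $H^{\mathrm{R}}_{k+1,k}$ of RR-GMRES satisfies $$\sigma_k(H^{\mathrm{R}}_{k+1,k}) \geq \sigma_r(A),$$ and its condition number is bounded above by that of $A$: $\kappa(H^{\mathrm{R}}_{k+1,k}) \leq \kappa(A)$.
   Context: $\mathcal{R}(\cdot)$ denotes range, $\|\cdot\|$ is the Euclidean vector norm and the induced matrix norm, $\sigma_i(\cdot)$ is the $i$th largest singular value (so $\sigma_r(A)$ is the smallest nonzero singular value of $A$), and $\kappa(M) = \|M\|\,\|M^\dagger\|$ with $M^\dagger$ the Moore-Penrose pseudoinverse. The system $A\boldsymbol{x}=\boldsymbol{b}$ is not assumed consistent. $\mathcal{K}_k(A,A\boldsymbol{r}_0) = \mathrm{span}\{A\boldsymbol{r}_0, A^2\boldsymbol{r}_0, \dots, A^{k}\boldsymbol{r}_0\}$. The range restricted GMRES method (RR-GMRES) minimizes $\|\boldsymbol{b}-A\boldsymbol{x}\|$ over $\boldsymbol{x}\in\boldsymbol{x}_0+\mathcal{K}_k(A,A\boldsymbol{r}_0)$. Its extended Hessenberg matrix $H^{\mathrm{R}}_{k+1,k}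 \in \mathbb{R}^{(k+1)\times k}$ comes from the Arnoldi decomposition $A Q^{\mathrm{R}}_k = Q^{\mathrm{R}}_{k+1} H^{\mathrm{R}}_{k+1,k}$, where $Q^{\mathrm{R}}_k = [\boldsymbol{q}^{\mathrm{R}}_1,\dots,\boldsymbol{q}^{\mathrm{R}}_k]$ has orthonormal columns with $\boldsymbol{q}^{\mathrm{R}}_1 = A\boldsymbol{r}_0/\|A\boldsymbol{r}_0\|$ and $\mathrm{span}\{\boldsymbol{q}^{\mathrm{R}}_1,\dots,\boldsymbol{q}^{\mathrm{R}}_i\} = \mathcal{K}_i(A,A\boldsymbol{r}_0)$ for $i\le k$, and $Q^{\mathrm{R}}_{k+1} = [Q^{\mathrm{R}}_k,\boldsymbol{q}^{\mathrm{R}}_{k+1}]$ where $\boldsymbol{q}^{\mathrm{R}}_{k+1}$ extends this to an orthonormal basis of $\mathcal{K}_{k+1}(A,A\boldsymbol{r}_0)$ if that space has dimension $k+1$; if it has dimension $k$, the last row of $H^{\mathrm{R}}_{k+1,k}$ is zero and $A Q^{\mathrm{R}}_k = Q^{\mathrm{R}}_k H^{\mathrm{R}}_{k,k}$ with $H^{\mathrm{R}}_{k,k}$ the first $k$ rows. In particular $\|A Q^{\mathrm{R}}_k \boldsymbol{w}\| = \|H^{\mathrm{R}}_{k+1,k}\boldsymbol{w}\|$ for all $\boldsymbol{w}\in\mathbb{R}^k$. *)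

theory Defs
  imports
    Jordan_Normal_Form.DL_Rank
    Jordan_Normal_Form.Char_Poly
    "HOL-Library.Multiset"
begin

definition vec_norm2 :: "real vec \<Rightarrow> real" where
  "vec_norm2 v = sqrt (v \<bullet> v)"

definition mat_norm2 :: "real mat \<Rightarrow> real" where
  "mat_norm2 M = (SUP x \<in> {x \<in> carrier_vec (dim_col M). vec_norm2 x \<le> 1}. vec_norm2 (M *\<^sub>v x))"

text \<open>The singular values of \<open>M\<close> are the square roots of the eigenvalues of \<open>M\<^sup>T M\<close>,
  repeated by algebraic multiplicity; \<open>singular_value M i\<close> is the \<open>i\<close>th largest, counted
  from 1, and is meant for \<open>1 \<le> i \<le> dim_col M\<close>.  If \<open>M\<close> is wide, the list is padded with
  zeros up to length \<open>dim_col M\<close>.\<close>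

definition singular_values :: "real mat \<Rightarrow> real list" where
  "singular_values M =
     rev (map sqrt (sorted_list_of_multiset (proots (char_poly (M\<^sup>T * M)))))"

definition singular_value :: "real mat \<Rightarrow> nat \<Rightarrow> real" where
  "singular_value M i = singular_values M ! (i - 1)"

text \<open>The four Penrose conditions.\<close>

definition is_pseudoinverse :: "real mat \<Rightarrow> real mat \<Rightarrow> bool" where
  "is_pseudoinverse M X \<longleftrightarrow>
     X \<in> carrier_mat (dim_col M) (dim_row M) \<and>
     M * X * M = M \<and> X * M * X = X \<and>
     (M * X)\<^sup>T = M * X \<and> (X * M)\<^sup>T = X * M"

definition pseudoinverse :: "real mat \<Rightarrow> real mat" where
  "pseudoinverse M = (THE X. is_pseudoinverse M X)"

definition condition_number :: "real mat \<Rightarrow> real" where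
  "condition_number M = mat_norm2 M * mat_norm2 (pseudoinverse M)"

context vec_space
begin

definition krylov :: "'a mat \<Rightarrow> 'a vec \<Rightarrow> nat \<Rightarrow> 'a vec set" where
  "krylov A v k = span ((\<lambda>i. (A ^\<^sub>m i) *\<^sub>v v) ` {..<k})"

definition krylov_dim :: "'a mat \<Rightarrow> 'a vec \<Rightarrow> nat \<Rightarrow> nat" where
  "krylov_dim A v k = vectorspace.dim class_ring (vs (krylov A v k))"

end

text \<open>The columns of \<open>Q\<close> are an orthonormal basis of the \<open>m\<close>th Krylov space generated by
  \<open>v\<close>, nested in the Krylov spaces of lower order.  Columns are counted from 0.\<close>

definition arnoldi_basis :: "nat \<Rightarrow> real mat \<Rightarrow> real vec \<Rightarrow> nat \<Rightarrow> real mat \<Rightarrow> bool" where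
  "arnoldi_basis n A v m Q \<longleftrightarrow>
     Q \<in> carrier_mat n m \<and>
     Q\<^sup>T * Q = 1\<^sub>m m \<and>
     col Q 0 = (1 / vec_norm2 v) \<cdot>\<^sub>v v \<and>
     (\<forall>i\<le>m. LinearCombinations.module.span class_ring (module_vec TYPE(real) n)
               (col Q ` {..<i}) = vec_space.krylov n A v i)"

text \<open>\<open>Q\<close> holds the first \<open>k\<close> Arnoldi vectors.  The second branch is the breakdown case,
  in which there is no vector number \<open>k + 1\<close>.\<close>

definition arnoldi_decomposition ::
  "nat \<Rightarrow> real mat \<Rightarrow> real vec \<Rightarrow> nat \<Rightarrow> real mat \<Rightarrow> real mat \<Rightarrow> bool" where
  "arnoldi_decomposition n A v k Q H \<longleftrightarrow>
     arnoldi_basis n A v k Q \<and>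
     H \<in> carrier_mat (k + 1) k \<and>
     (if vec_space.krylov_dim n A v (k + 1) = k + 1
      then \<exists>q \<in> carrier_vec n.
             arnoldi_basis n A v (k + 1) (mat_of_cols n (cols Q @ [q])) \<and>
             A * Q = mat_of_cols n (cols Q @ [q]) * H
      else row H k = 0\<^sub>v k \<and> A * Q = Q * mat k k (\<lambda>(i, j). H $$ (i, j)))"

text \<open>The Arnoldi vectors, and hence \<open>H\<close>, are determined only up to signs, so this is a
  predicate on \<open>H\<close>.  The starting vector is \<open>A r0\<close>, not \<open>r0\<close> as in standard GMRES.\<close>

definition rrgmres_hessenberg ::
  "nat \<Rightarrow> real mat \<Rightarrow> real vec \<Rightarrow> nat \<Rightarrow> real mat \<Rightarrow> bool" where
  "rrgmres_hessenberg n A r0 k H \<longleftrightarrow> (\<exists>Q. arnoldi_decomposition n A (A *\<^sub>v r0) k Q H)"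

end

theory Submission
  imports Defs Jordan_Normal_Form.Spectral_Radius
begin

text \<open>
  The Krylov space generated by \<open>A r0\<close> lies in \<open>R(A) = R(A\<^sup>T)\<close>, so \<open>Q w\<close> is orthogonal
  to the kernel of \<open>A\<close> for every \<open>w\<close>. On that orthogonal complement, \<open>A\<close> stretches
  lengths by at least its smallest nonzero singular value, and the pseudoinverse of \<open>A\<close> inverts \<open>A\<close>. Since
  \<open>\<parallel>H w\<parallel> = \<parallel>A Q w\<parallel>\<close> and \<open>\<parallel>Q w\<parallel> = \<parallel>w\<parallel>\<close>, the same bounds hold for \<open>H\<close>. That \<open>\<sigma>\<^sub>r(A)\<close>,
  an entry of a sorted list of characteristic roots, is a lower bound for the nonzero singular
  values follows from the real spectral theorem: the eigenvectors of \<open>A\<^sup>T A\<close> for nonzero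
  eigenvalues are linearly independent in \<open>R(A\<^sup>T) = R(A)\<close>, so there are at most \<open>r\<close> of them.
\<close>

section \<open>Spectral theorem for real symmetric matrices\<close>

lemma scalar_prod_mult_mat_vec:
  fixes M :: "real mat"
  assumes "M \<in> carrier_mat nr nc" "x \<in> carrier_vec nc" "y \<in> carrier_vec nr"
  shows "(M *\<^sub>v x) \<bullet> y = x \<bullet> (M\<^sup>T *\<^sub>v y)"
  using transpose_vec_mult_scalar[OF assms] assms
  by (metis comm_scalar_prod mult_mat_vec_carrier transpose_carrier_mat)

lemma self_scalar_prod_ge_0: "(v::real vec) \<bullet> v \<ge> 0"
  by (auto simp: scalar_prod_def intro!: sum_nonneg)

lemma self_scalar_prod_eq_0_iff:
  assumes "(v::real vec) \<in> carrier_vec n"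
  shows "v \<bullet> v = 0 \<longleftrightarrow> v = 0\<^sub>v n"
  using conjugate_square_eq_0_vec[OF assms] by simp

text \<open>Over the complex numbers some eigenvector \<open>z = x + i y\<close> exists. Symmetry
  forces its eigenvalue \<open>l\<close> to be real, and then \<open>x\<close> and \<open>y\<close>
  each satisfy the eigenvalue equation; at least one of them is nonzero.\<close>

lemma symmetric_real_eigenvector:
  fixes S :: "real mat"
  assumes S: "S \<in> carrier_mat n n" and sym: "S\<^sup>T = S" and n: "n > 0"
  shows "\<exists>v e. v \<in> carrier_vec n \<and> v \<noteq> 0\<^sub>v n \<and> S *\<^sub>v v = e \<cdot>\<^sub>v v"
proof -
  let ?C = "map_mat complex_of_real S"
  have C: "?C \<in> carrier_mat n n" using S by auto
  obtain l where "eigenvalue ?C l"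
    using spectrum_non_empty[OF C n] unfolding spectrum_def by auto
  then obtain z where "eigenvector ?C z l"
    unfolding eigenvalue_def by auto
  then have z: "z \<in> carrier_vec n" "z \<noteq> 0\<^sub>v n" "?C *\<^sub>v z = l \<cdot>\<^sub>v z"
    using S unfolding eigenvector_def by auto
  define x y where "x = map_vec Re z" and "y = map_vec Im z"
  have x: "x \<in> carrier_vec n" and y: "y \<in> carrier_vec n" using z by (auto simp: x_def y_def)
  have entry: "(\<Sum>j<n. complex_of_real (S $$ (i,j)) * z $ j) = l * z $ i" if "i < n" for i
    using arg_cong[OF z(3), of "\<lambda>v. v $ i"] that S z(1)
    by (simp add: scalar_prod_def lessThan_atLeast0)
  \<comment> \<open>Real part of \<open>S z = l z\<close>; the imaginary part follows below. Both
    use that the entries of \<open>S\<close> are real.\<close>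
  have Sx: "S *\<^sub>v x = Re l \<cdot>\<^sub>v x - Im l \<cdot>\<^sub>v y"
  proof (rule eq_vecI)
    fix i assume "i < dim_vec (Re l \<cdot>\<^sub>v x - Im l \<cdot>\<^sub>v y)"
    then have i: "i < n" using y by simp
    show "(S *\<^sub>v x) $ i = (Re l \<cdot>\<^sub>v x - Im l \<cdot>\<^sub>v y) $ i"
      using arg_cong[OF entry[OF i], of Re] i S z(1)
      by (simp add: scalar_prod_def lessThan_atLeast0 x_def y_def)
  qed (use S y in auto)
  have Sy: "S *\<^sub>v y = Im l \<cdot>\<^sub>v x + Re l \<cdot>\<^sub>v y"
  proof (rule eq_vecI)
    fix i assume "i < dim_vec (Im l \<cdot>\<^sub>v x + Re l \<cdot>\<^sub>v y)"
    then have i: "i < n" using y by simp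
    show "(S *\<^sub>v y) $ i = (Im l \<cdot>\<^sub>v x + Re l \<cdot>\<^sub>v y) $ i"
      using arg_cong[OF entry[OF i], of Im] i S z(1)
      by (simp add: scalar_prod_def lessThan_atLeast0 x_def y_def)
  qed (use S y in auto)
  have "(S *\<^sub>v x) \<bullet> y = x \<bullet> (S *\<^sub>v y)"
    using scalar_prod_mult_mat_vec[OF S x y] sym by simp
  \<comment> \<open>Expanding both sides of the symmetry identity, the terms with
    \<open>Re l\<close> cancel and only those with \<open>Im l\<close> remain.\<close>
  then have "Im l * (x \<bullet> x + y \<bullet> y) = 0"
    unfolding Sx Sy using x y
    by (simp add: minus_scalar_prod_distrib[of _ n] scalar_prod_add_distrib[of _ n] algebra_simps)
  moreover have nz: "x \<noteq> 0\<^sub>v n \<or> y \<noteq> 0\<^sub>v n"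
  proof (rule ccontr)
    assume "\<not> ?thesis"
    then have h: "x = 0\<^sub>v n" "y = 0\<^sub>v n" by auto
    have "z = 0\<^sub>v n"
    proof (rule eq_vecI)
      fix i assume "i < dim_vec (0\<^sub>v n :: complex vec)"
      then have i: "i < n" by simp
      show "z $ i = 0\<^sub>v n $ i"
        using arg_cong[OF h(1), of "\<lambda>v. v $ i"] arg_cong[OF h(2), of "\<lambda>v. v $ i"] i z(1)
        by (simp add: x_def y_def complex_eq_iff)
    qed (use z in auto)
    with z show False by simp
  qed
  moreover have "x \<bullet> x + y \<bullet> y \<noteq> 0"
    using nz self_scalar_prod_eq_0_iff[OF x] self_scalar_prod_eq_0_iff[OF y]
      self_scalar_prod_ge_0[of x] self_scalar_prod_ge_0[of y] by linarith
  ultimately have "Im l = 0" by simp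
  then have "S *\<^sub>v x = Re l \<cdot>\<^sub>v x" "S *\<^sub>v y = Re l \<cdot>\<^sub>v y"
    unfolding Sx Sy using x y by auto
  with nz x y show ?thesis by blast
qed

text \<open>Complete \<open>v\<close> to a basis, apply Gram-Schmidt, which keeps the first vector,
  and normalise. Only the direction of column 0 matters later, so its scale is left as an
  unspecified \<open>c\<close>.\<close>

lemma orthonormal_completion:
  fixes v :: "real vec"
  assumes v: "v \<in> carrier_vec n" and v0: "v \<noteq> 0\<^sub>v n"
  shows "\<exists>U \<in> carrier_mat n n. U\<^sup>T * U = 1\<^sub>m n \<and> (\<exists>c. col U 0 = c \<cdot>\<^sub>v v)"
proof -
  interpret cof_vec_space n "TYPE(real)" .
  note b = basis_completion[OF v v0]
  define ws where "ws = gram_schmidt n (basis_completion v)"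
  note gs = gram_schmidt_result[OF b(2,4,5) ws_def]
  have n: "n > 0" using v v0 by (metis carrier_vecD gr0I vec_of_dim_0)
  have len: "length ws = n" using gs b by simp
  have "hd ws = v"
    using gram_schmidt_hd[OF v] b(7) unfolding ws_def basis_completion_def Let_def by simp
  then have ws0: "ws ! 0 = v" using len n by (metis hd_conv_nth length_greater_0_conv)
  have wsc: "ws ! i \<in> carrier_vec n" if "i < n" for i
    using gs(3) len that by (metis nth_mem subsetD)
  define f where "f w = (1 / vec_norm2 w) \<cdot>\<^sub>v w" for w :: "real vec"
  define U where "U = mat_of_cols n (map f ws)"
  have U: "U \<in> carrier_mat n n" unfolding U_def using len by auto
  have colU: "col U i = f (ws ! i)" if "i < n" for i
    using wsc that len unfolding U_def f_def by simp
  have "U\<^sup>T * U = 1\<^sub>m n"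
  proof (rule eq_matI)
    fix i j assume "i < dim_row (1\<^sub>m n :: real mat)" "j < dim_col (1\<^sub>m n :: real mat)"
    then have ij: "i < n" "j < n" by auto
    have "(U\<^sup>T * U) $$ (i,j) = f (ws ! i) \<bullet> f (ws ! j)"
      using U ij colU by simp
    also have "\<dots> = (ws ! i \<bullet> ws ! j) / (vec_norm2 (ws ! i) * vec_norm2 (ws ! j))"
      unfolding f_def using wsc[OF ij(1)] wsc[OF ij(2)]
      by (simp add: smult_scalar_prod_distrib[of _ n] scalar_prod_smult_distrib[of _ n])
    \<comment> \<open>Orthogonality of the list states that a product vanishes exactly when the
      indices differ, so it also gives the nonzero norms needed on the diagonal.\<close>
    also have "\<dots> = 1\<^sub>m n $$ (i,j)"
      using corthogonalD[OF gs(2), of i j] ij len self_scalar_prod_ge_0[of "ws ! i"]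
      by (auto simp: vec_norm2_def)
    finally show "(U\<^sup>T * U) $$ (i,j) = 1\<^sub>m n $$ (i,j)" .
  qed (use U in auto)
  moreover have "col U 0 = (1 / vec_norm2 v) \<cdot>\<^sub>v v"
    using colU[OF n] ws0 unfolding f_def by simp
  ultimately show ?thesis using U by blast
qed

lemma orthogonal_mat_right_inverse:
  fixes U :: "real mat"
  assumes "U \<in> carrier_mat n n" "U\<^sup>T * U = 1\<^sub>m n"
  shows "U * U\<^sup>T = 1\<^sub>m n"
  using mat_mult_left_right_inverse[of "U\<^sup>T" n U] assms by simp

lemma orthogonal_conjugation_inverse:
  fixes U :: "real mat"
  assumes U: "U \<in> carrier_mat n n" "U\<^sup>T * U = 1\<^sub>m n" and S: "S \<in> carrier_mat n n"
    and eq: "U\<^sup>T * S * U = B"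
  shows "S = U * B * U\<^sup>T"
proof -
  have "U * B * U\<^sup>T = (U * U\<^sup>T) * S * (U * U\<^sup>T)"
    unfolding eq[symmetric] using U(1) S
    by (simp add: assoc_mult_mat[where ?n\<^sub>1 = n and ?n\<^sub>2 = n and ?n\<^sub>3 = n and ?n\<^sub>4 = n])
  then show ?thesis using orthogonal_mat_right_inverse[OF U] S by simp
qed

text \<open>Induction on \<open>n\<close> by deflation: in an orthonormal basis starting with an
  eigenvector, \<open>S\<close> becomes block diagonal with blocks \<open>e\<close> and a smaller
  symmetric \<open>T\<close>, to which the induction hypothesis applies.\<close>

theorem spectral_theorem_real:
  fixes S :: "real mat"
  assumes "S \<in> carrier_mat n n" and "S\<^sup>T = S"
  shows "\<exists>U \<in> carrier_mat n n. \<exists>d. U\<^sup>T * U = 1\<^sub>m n \<and> S = U * mat_diag n d * U\<^sup>T"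
  using assms
proof (induction n arbitrary: S)
  case 0
  then show ?case by (intro bexI[of _ "1\<^sub>m 0"] exI) auto
next
  case (Suc m)
  let ?n = "Suc m"
  note S = Suc.prems
  obtain v e where v: "v \<in> carrier_vec ?n" "v \<noteq> 0\<^sub>v ?n" "S *\<^sub>v v = e \<cdot>\<^sub>v v"
    using symmetric_real_eigenvector[OF S] by auto
  obtain W c where W: "W \<in> carrier_mat ?n ?n" "W\<^sup>T * W = 1\<^sub>m ?n" "col W 0 = c \<cdot>\<^sub>v v"
    using orthonormal_completion[OF v(1,2)] by blast
  define B where "B = W\<^sup>T * S * W"
  have B: "B \<in> carrier_mat ?n ?n" using W S by (simp add: B_def)
  have SW: "S = W * B * W\<^sup>T" by (rule orthogonal_conjugation_inverse[OF W(1,2) S(1)]) (simp add: B_def)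
  have Bsym: "B\<^sup>T = B"
    unfolding B_def using W S
    by (simp add: transpose_mult[where ?nr = ?n and ?n = ?n and ?nc = ?n] assoc_mult_mat[where ?n\<^sub>1 = ?n and ?n\<^sub>2 = ?n and ?n\<^sub>3 = ?n and ?n\<^sub>4 = ?n])
  \<comment> \<open>Column 0 of \<open>W\<close> is an eigenvector and the columns of
    \<open>W\<close> are orthonormal, so the first column of \<open>B\<close> is \<open>e\<close>
    times the first unit vector. Symmetry of \<open>B\<close> then settles the first row.\<close>
  have B0: "B $$ (i, 0) = (if i = 0 then e else 0)" if i: "i < ?n" for i
  proof -
    have "B $$ (i, 0) = (W\<^sup>T * (S * W)) $$ (i, 0)"
      using W S by (simp add: B_def assoc_mult_mat[where ?n\<^sub>1 = ?n and ?n\<^sub>2 = ?n and ?n\<^sub>3 = ?n and ?n\<^sub>4 = ?n])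
    also have "\<dots> = col W i \<bullet> (S *\<^sub>v col W 0)"
    proof -
      have "(W\<^sup>T * (S * W)) $$ (i, 0) = col W i \<bullet> col (S * W) 0"
        using W(1) S(1) i by (subst index_mult_mat) auto
      then show ?thesis using col_mult2[OF S(1) W(1), of 0] by simp
    qed
    also have "S *\<^sub>v col W 0 = e \<cdot>\<^sub>v col W 0"
      using W(3) v S(1) mult_mat_vec[OF S(1) v(1)] by (simp add: smult_smult_assoc mult.commute)
    also have "col W i \<bullet> (e \<cdot>\<^sub>v col W 0) = e * (W\<^sup>T * W) $$ (i,0)"
      using W(1) i by simp
    also have "\<dots> = (if i = 0 then e else 0)" using W(2) i by simp
    finally show ?thesis .
  qed
  have B0': "B $$ (0, i) = (if i = 0 then e else 0)" if "i < ?n" for i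
    using B0[OF that] Bsym B that by (metis carrier_matD index_transpose_mat(1) zero_less_Suc)
  define T where "T = mat m m (\<lambda>(i,j). B $$ (Suc i, Suc j))"
  let ?fb = "\<lambda>a X. four_block_mat (mat 1 1 (\<lambda>_. a)) (0\<^sub>m 1 m) (0\<^sub>m m 1) X"
  have T: "T \<in> carrier_mat m m" by (simp add: T_def)
  have Bfb: "B = ?fb e T"
    by (rule eq_matI) (use B B0 B0' T in \<open>auto simp: T_def\<close>)
  have "T\<^sup>T = T"
    by (rule eq_matI) (use B Bsym in \<open>auto simp: T_def, metis B Suc_less_eq carrier_matD index_transpose_mat(1)\<close>)
  from Suc.IH[OF T this] obtain V d where V: "V \<in> carrier_mat m m" "V\<^sup>T * V = 1\<^sub>m m"
      "T = V * mat_diag m d * V\<^sup>T" by auto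
  define d' where "d' i = (case i of 0 \<Rightarrow> e | Suc j \<Rightarrow> d j)" for i
  have D: "mat_diag ?n d' = ?fb e (mat_diag m d)"
    by (rule eq_matI) (auto simp: mat_diag_def d'_def split: nat.split)
  \<comment> \<open>\<open>P\<close> leaves the split-off coordinate alone and acts as
    \<open>V\<close> on the rest; the diagonalising matrix for \<open>S\<close> is then
    \<open>W * P\<close>.\<close>
  define P where "P = ?fb 1 V"
  have P: "P \<in> carrier_mat ?n ?n"
    using four_block_carrier_mat[of "mat 1 1 (\<lambda>_. 1)" 1 1 V m m] V by (simp add: P_def)
  have Pt: "P\<^sup>T = ?fb 1 (V\<^sup>T)"
    unfolding P_def using V by (subst transpose_four_block_mat[of _ 1 1 _ m _ m]) (auto intro!: cong_four_block_mat eq_matI)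
  have mult: "?fb a X * ?fb b Y = ?fb (a * b) (X * Y)"
    if "X \<in> carrier_mat m m" "Y \<in> carrier_mat m m" for a b :: real and X Y
    using that by (subst mult_four_block_mat[of _ 1 1 _ m _ m _ _ 1 _ m])
      (auto intro!: cong_four_block_mat eq_matI simp: scalar_prod_def)
  have "P\<^sup>T * P = ?fb (1 * 1) (V\<^sup>T * V)"
    unfolding Pt unfolding P_def using V by (intro mult) auto
  also have "\<dots> = 1\<^sub>m ?n"
    unfolding V(2) by (rule eq_matI) auto
  finally have "P\<^sup>T * P = 1\<^sub>m ?n" .
  moreover have "B = P * mat_diag ?n d' * P\<^sup>T"
  proof -
    have "P * mat_diag ?n d' = ?fb (1 * e) (V * mat_diag m d)"
      unfolding P_def D using V by (intro mult) auto
    also have "\<dots> * P\<^sup>T = ?fb (1 * e * 1) (V * mat_diag m d * V\<^sup>T)"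
      unfolding Pt using V mult_carrier_mat[of V m m "mat_diag m d" m] by (intro mult) auto
    finally show ?thesis unfolding Bfb V(3)[symmetric] by simp
  qed
  moreover obtain D' where D': "D' = mat_diag ?n d'" "D' \<in> carrier_mat ?n ?n" by simp
  ultimately have "(W * P)\<^sup>T * (W * P) = 1\<^sub>m ?n \<and> S = (W * P) * mat_diag ?n d' * (W * P)\<^sup>T"
  proof (intro conjI)
    assume PP: "P\<^sup>T * P = 1\<^sub>m ?n" and BP: "B = P * mat_diag ?n d' * P\<^sup>T"
    have "(W * P)\<^sup>T * (W * P) = P\<^sup>T * (W\<^sup>T * W) * P"
      using W(1) P by (simp add: transpose_mult[where ?nr = ?n and ?n = ?n and ?nc = ?n]
          assoc_mult_mat[where ?n\<^sub>1 = ?n and ?n\<^sub>2 = ?n and ?n\<^sub>3 = ?n and ?n\<^sub>4 = ?n])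
    then show "(W * P)\<^sup>T * (W * P) = 1\<^sub>m ?n" using W P PP by simp
    show "S = (W * P) * mat_diag ?n d' * (W * P)\<^sup>T"
      unfolding SW BP D'(1)[symmetric]
      using W(1) P D'(2)
      by (simp add: transpose_mult[where ?nr = ?n and ?n = ?n and ?nc = ?n]
          assoc_mult_mat[where ?n\<^sub>1 = ?n and ?n\<^sub>2 = ?n and ?n\<^sub>3 = ?n and ?n\<^sub>4 = ?n])
  qed
  then show ?case using W P by (intro bexI[of _ "W * P"]) auto
qed

section \<open>Norms\<close>

lemma vec_norm2_ge_0 [simp]: "vec_norm2 v \<ge> 0"
  by (simp add: vec_norm2_def self_scalar_prod_ge_0)

lemma vec_norm2_le_iff: "vec_norm2 v \<le> vec_norm2 w \<longleftrightarrow> v \<bullet> v \<le> w \<bullet> w"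
  by (simp add: vec_norm2_def)

lemma vec_norm2_smult: "vec_norm2 (c \<cdot>\<^sub>v v) = \<bar>c\<bar> * vec_norm2 v"
proof -
  have "(c \<cdot>\<^sub>v v) \<bullet> (c \<cdot>\<^sub>v v) = c\<^sup>2 * (v \<bullet> v)"
    by (simp add: scalar_prod_def sum_distrib_left power2_eq_square mult_ac)
  then show ?thesis by (simp add: vec_norm2_def real_sqrt_mult)
qed

lemma scalar_prod_mult_mat_vec_self:
  fixes M :: "real mat"
  assumes "M \<in> carrier_mat nr nc" "x \<in> carrier_vec nc"
  shows "(M *\<^sub>v x) \<bullet> (M *\<^sub>v x) = x \<bullet> ((M\<^sup>T * M) *\<^sub>v x)"
  using scalar_prod_mult_mat_vec[OF assms, of "M *\<^sub>v x"] assms by simp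

text \<open>The real supremum in \<open>mat_norm2\<close> is only informative for a bounded set. On
  the unit ball each coordinate is at most 1 in modulus, so entry \<open>i\<close> of the image is
  bounded by the absolute row sum \<open>c i\<close>.\<close>

lemma mat_norm2_bdd_above:
  "bdd_above ((\<lambda>x. vec_norm2 (M *\<^sub>v x)) ` {x \<in> carrier_vec (dim_col M). vec_norm2 x \<le> 1})"
proof -
  define c where "c i = (\<Sum>j<dim_col M. \<bar>M $$ (i,j)\<bar>)" for i
  show ?thesis
  proof (rule bdd_aboveI2)
    fix x assume x: "x \<in> {x \<in> carrier_vec (dim_col M). vec_norm2 x \<le> 1}"
    have xj: "\<bar>x $ j\<bar> \<le> 1" if "j < dim_col M" for j
    proof -
      have "x $ j * x $ j \<le> x \<bullet> x"
        unfolding scalar_prod_def using that x by (intro member_le_sum) auto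
      also have "\<dots> \<le> 1" using x by (simp add: vec_norm2_def)
      finally show ?thesis using abs_square_le_1[of "x $ j"] by (simp add: power2_eq_square)
    qed
    have "\<bar>(M *\<^sub>v x) $ i\<bar> \<le> c i" if "i < dim_row M" for i
    proof -
      have "\<bar>(M *\<^sub>v x) $ i\<bar> = \<bar>\<Sum>j<dim_col M. M $$ (i,j) * x $ j\<bar>"
        using that x
        by (auto simp: scalar_prod_def lessThan_atLeast0 intro!: arg_cong[of _ _ abs] sum.cong)
      also have "\<dots> \<le> (\<Sum>j<dim_col M. \<bar>M $$ (i,j) * x $ j\<bar>)" by (rule sum_abs)
      also have "\<dots> \<le> c i" unfolding c_def
        using xj by (intro sum_mono) (auto simp: abs_mult intro: mult_left_le)
      finally show ?thesis .
    qed
    then have "(M *\<^sub>v x) $ i * (M *\<^sub>v x) $ i \<le> c i * c i" if "i < dim_row M" for i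
      using that by (metis abs_le_square_iff abs_of_nonneg abs_ge_zero order_trans power2_eq_square)
    then have "(M *\<^sub>v x) \<bullet> (M *\<^sub>v x) \<le> (\<Sum>i<dim_row M. c i * c i)"
      unfolding scalar_prod_def dim_mult_mat_vec lessThan_atLeast0 by (intro sum_mono) auto
    then show "vec_norm2 (M *\<^sub>v x) \<le> sqrt (\<Sum>i<dim_row M. c i * c i)"
      by (simp add: vec_norm2_def)
  qed
qed

text \<open>Homogeneity: a nonzero \<open>x\<close> is rescaled to the unit sphere, where the
  supremum applies.\<close>

lemma vec_norm2_mult_le:
  assumes M: "M \<in> carrier_mat nr nc" and x: "x \<in> carrier_vec nc"
  shows "vec_norm2 (M *\<^sub>v x) \<le> mat_norm2 M * vec_norm2 x"
proof (cases "vec_norm2 x = 0")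
  case True
  then have "x = 0\<^sub>v nc" using self_scalar_prod_eq_0_iff[OF x] by (simp add: vec_norm2_def)
  then have "M *\<^sub>v x = 0\<^sub>v nr" using M by (intro eq_vecI) auto
  then show ?thesis using True by (simp add: vec_norm2_def)
next
  case False
  then have pos: "vec_norm2 x > 0" using vec_norm2_ge_0[of x] by linarith
  let ?y = "(1 / vec_norm2 x) \<cdot>\<^sub>v x"
  have "vec_norm2 (M *\<^sub>v ?y) \<le> mat_norm2 M"
    unfolding mat_norm2_def using M x pos
    by (intro cSUP_upper[OF _ mat_norm2_bdd_above]) (auto simp: vec_norm2_smult)
  also have "M *\<^sub>v ?y = (1 / vec_norm2 x) \<cdot>\<^sub>v (M *\<^sub>v x)"
    using mult_mat_vec[OF M x] by simp
  finally show ?thesis using pos by (simp add: vec_norm2_smult field_simps)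
qed

lemma mat_norm2_leI:
  assumes M: "M \<in> carrier_mat nr nc" and c: "c \<ge> 0"
    and le: "\<And>x. x \<in> carrier_vec nc \<Longrightarrow> vec_norm2 (M *\<^sub>v x) \<le> c * vec_norm2 x"
  shows "mat_norm2 M \<le> c"
  unfolding mat_norm2_def
proof (rule cSUP_least)
  have "0\<^sub>v nc \<in> {x \<in> carrier_vec (dim_col M). vec_norm2 x \<le> 1}"
    using M by (auto simp: vec_norm2_def)
  then show "{x \<in> carrier_vec (dim_col M). vec_norm2 x \<le> 1} \<noteq> {}" by blast
  fix x assume "x \<in> {x \<in> carrier_vec (dim_col M). vec_norm2 x \<le> 1}"
  then have x: "x \<in> carrier_vec nc" "vec_norm2 x \<le> 1" using M by auto
  show "vec_norm2 (M *\<^sub>v x) \<le> c"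
    using le[OF x(1)] mult_left_mono[OF x(2) c] by simp
qed

lemma mat_norm2_ge_0: "mat_norm2 M \<ge> 0"
proof -
  let ?z = "0\<^sub>v (dim_col M) :: real vec"
  have "vec_norm2 (M *\<^sub>v ?z) \<le> mat_norm2 M"
    unfolding mat_norm2_def
    by (intro cSUP_upper[OF _ mat_norm2_bdd_above]) (auto simp: vec_norm2_def)
  then show ?thesis using vec_norm2_ge_0 order_trans by blast
qed

section \<open>Pseudoinverse\<close>

text \<open>The spectral theorem for \<open>M\<^sup>T * M\<close>: the columns of \<open>U\<close>
  are right singular vectors of \<open>M\<close> and the \<open>d i\<close> are the squared singular
  values, in no particular order.\<close>

lemma gram_diagonalization:
  fixes M :: "real mat"
  assumes M: "M \<in> carrier_mat nr nc"
  obtains U d where "U \<in> carrier_mat nc nc" "U\<^sup>T * U = 1\<^sub>m nc"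
    "M\<^sup>T * M = U * mat_diag nc d * U\<^sup>T"
    "\<And>i. i < nc \<Longrightarrow> (M\<^sup>T * M) *\<^sub>v col U i = d i \<cdot>\<^sub>v col U i"
    "\<And>i. i < nc \<Longrightarrow> (M *\<^sub>v col U i) \<bullet> (M *\<^sub>v col U i) = d i"
proof -
  let ?S = "M\<^sup>T * M"
  have S: "?S \<in> carrier_mat nc nc" using M by simp
  have "?S\<^sup>T = ?S" using M by (simp add: transpose_mult[where ?nr = nc and ?n = nr and ?nc = nc])
  from spectral_theorem_real[OF S this] obtain U d
    where U: "U \<in> carrier_mat nc nc" "U\<^sup>T * U = 1\<^sub>m nc" and SU: "?S = U * mat_diag nc d * U\<^sup>T"
    by blast
  obtain D where D: "D = mat_diag nc d" "D \<in> carrier_mat nc nc" by simp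
  have "?S * U = U * D * (U\<^sup>T * U)"
    unfolding SU D(1)[symmetric] using U(1) D(2)
    by (simp add: assoc_mult_mat[where ?n\<^sub>1 = nc and ?n\<^sub>2 = nc and ?n\<^sub>3 = nc and ?n\<^sub>4 = nc])
  then have SU': "?S * U = U * mat_diag nc d"
    using U D by (simp add: right_mult_one_mat[of _ nc nc])
  have eig: "?S *\<^sub>v col U i = d i \<cdot>\<^sub>v col U i" if i: "i < nc" for i
  proof -
    have "?S *\<^sub>v col U i = col (U * mat_diag nc d) i"
      using col_mult2[OF S U(1) i] SU' by simp
    also have "\<dots> = d i \<cdot>\<^sub>v col U i"
      unfolding mat_diag_mult_right[OF U(1)] using U(1) i by (intro eq_vecI) auto
    finally show ?thesis .
  qed
  have norm: "(M *\<^sub>v col U i) \<bullet> (M *\<^sub>v col U i) = d i" if i: "i < nc" for i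
  proof -
    have "col U i \<bullet> col U i = (U\<^sup>T * U) $$ (i,i)" using U(1) i by simp
    then have "col U i \<bullet> col U i = 1" using U(2) i by simp
    moreover have ci: "col U i \<in> carrier_vec nc" using U(1) i by auto
    ultimately show ?thesis
      using scalar_prod_mult_mat_vec_self[OF M ci] eig[OF i] by simp
  qed
  show thesis by (rule that[OF U SU eig norm])
qed

text \<open>The witness is the pseudoinverse of the Gram matrix \<open>M\<^sup>T * M\<close> times
  \<open>M\<^sup>T\<close>. The former comes from the diagonalisation by inverting the nonzero
  \<open>d i\<close> and keeping the zeros.\<close>

lemma is_pseudoinverse_exists: "\<exists>X. is_pseudoinverse M X"
proof -
  define nr nc where "nr = dim_row M" and "nc = dim_col M"
  have M: "M \<in> carrier_mat nr nc" by (simp add: nr_def nc_def)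
  obtain U d where U: "U \<in> carrier_mat nc nc" "U\<^sup>T * U = 1\<^sub>m nc"
    and S: "M\<^sup>T * M = U * mat_diag nc d * U\<^sup>T"
    and norm: "\<And>i. i < nc \<Longrightarrow> (M *\<^sub>v col U i) \<bullet> (M *\<^sub>v col U i) = d i"
    using gram_diagonalization[OF M] by metis
  note UU = orthogonal_mat_right_inverse[OF U]
  define E where "E = mat_diag nc (\<lambda>i. if d i = 0 then 0 else 1 / d i)"
  define D where "D = mat_diag nc d"
  define P where "P = mat_diag nc (\<lambda>i. if d i = 0 then 0 else 1 :: real)"
  have C: "E \<in> carrier_mat nc nc" "D \<in> carrier_mat nc nc" "P \<in> carrier_mat nc nc"
    unfolding E_def D_def P_def by auto
  have diag: "E * D = P" "P * E = E"
    unfolding E_def D_def P_def by (auto intro!: eq_matI simp: mat_diag_diag, auto simp: mat_diag_def)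
  have sym: "E\<^sup>T = E" "P\<^sup>T = P"
    unfolding E_def P_def by (auto intro!: eq_matI simp: mat_diag_def)
  \<comment> \<open>\<open>P\<close> deletes the columns of \<open>M * U\<close> with
    \<open>d j = 0\<close>. These have squared norm \<open>d j\<close>, so they vanish
    already.\<close>
  have MUP: "(M * U) * P = M * U"
  proof -
    have zero: "(M * U) $$ (i,j) = 0" if "i < nr" "j < nc" "d j = 0" for i j
    proof -
      have "M *\<^sub>v col U j = 0\<^sub>v nr"
        using norm[OF that(2)] that(3) self_scalar_prod_eq_0_iff[of "M *\<^sub>v col U j" nr]
          mult_mat_vec_carrier[OF M, of "col U j"] col_carrier_vec[OF that(2) U(1)] by simp
      then have "(M *\<^sub>v col U j) $ i = 0" using that by simp
      then show ?thesis using M U that by simp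
    qed
    have MU: "M * U \<in> carrier_mat nr nc" using M U by simp
    show ?thesis
      unfolding P_def mat_diag_mult_right[OF MU]
      using M U(1) zero by (intro eq_matI) (auto simp del: index_mult_mat(1))
  qed
  define X where "X = U * E * U\<^sup>T * M\<^sup>T"
  have X: "X \<in> carrier_mat nc nr" unfolding X_def using U C M by (intro mult_carrier_mat[of _ nc nc]) auto
  have Ut: "U\<^sup>T \<in> carrier_mat nc nc" and Mt: "M\<^sup>T \<in> carrier_mat nc nr" using U M by auto
  note am = assoc_mult_mat[where ?n\<^sub>1 = nc and ?n\<^sub>2 = nc and ?n\<^sub>3 = nc and ?n\<^sub>4 = nc]
  have XM: "X * M = U * P * U\<^sup>T"
  proof -
    have "X * M = U * E * U\<^sup>T * (M\<^sup>T * M)"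
      unfolding X_def using U(1) C M by (intro assoc_mult_mat[of _ nc nc _ nr _ nc]) auto
    also have "\<dots> = U * E * (U\<^sup>T * U) * D * U\<^sup>T"
      unfolding S D_def[symmetric] using U(1) C by (simp add: am)
    also have "\<dots> = U * (E * D) * U\<^sup>T" unfolding U(2) using U(1) C by (simp add: am)
    finally show ?thesis unfolding diag .
  qed
  have "M * X * M = M * (U * P * U\<^sup>T)"
    unfolding XM[symmetric] using M X by (intro assoc_mult_mat[of _ nr nc _ nr _ nc]) auto
  also have "\<dots> = ((M * U) * P) * U\<^sup>T"
    using M U(1) C by (simp add: assoc_mult_mat[where ?n\<^sub>1 = nr and ?n\<^sub>2 = nc and ?n\<^sub>3 = nc and ?n\<^sub>4 = nc])
  also have "\<dots> = M * (U * U\<^sup>T)"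
    unfolding MUP using M U(1) by (intro assoc_mult_mat[of _ nr nc _ nc _ nc]) auto
  also have "\<dots> = M" unfolding UU using M by simp
  finally have 1: "M * X * M = M" .
  have "X * M * X = (U * P * U\<^sup>T) * (U * E * U\<^sup>T) * M\<^sup>T"
    unfolding XM unfolding X_def using U(1) C M
    by (subst assoc_mult_mat[of _ nc nc _ nc _ nr, symmetric]) auto
  also have "(U * P * U\<^sup>T) * (U * E * U\<^sup>T) = U * P * (U\<^sup>T * U) * E * U\<^sup>T"
    using U(1) C by (simp add: am)
  also have "\<dots> = U * (P * E) * U\<^sup>T" unfolding U(2) using U(1) C by (simp add: am)
  also have "U * (P * E) * U\<^sup>T * M\<^sup>T = X" unfolding diag X_def ..
  finally have 2: "X * M * X = X" .
  have 3: "(X * M)\<^sup>T = X * M"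
    unfolding XM using U(1) C
    by (simp add: transpose_mult[where ?nr = nc and ?n = nc and ?nc = nc] sym am)
  \<comment> \<open>A congruence of the diagonal matrix \<open>E\<close>, which makes the symmetry
    of \<open>M * X\<close> visible.\<close>
  have MX: "M * X = M * U * E * (M * U)\<^sup>T"
    unfolding X_def transpose_mult[OF M U(1)] using M U(1) C Ut Mt
    by (simp add: assoc_mult_mat[where ?n\<^sub>1 = nr and ?n\<^sub>2 = nc and ?n\<^sub>3 = nc and ?n\<^sub>4 = nr]
        assoc_mult_mat[where ?n\<^sub>1 = nc and ?n\<^sub>2 = nc and ?n\<^sub>3 = nc and ?n\<^sub>4 = nr]
        assoc_mult_mat[where ?n\<^sub>1 = nr and ?n\<^sub>2 = nc and ?n\<^sub>3 = nc and ?n\<^sub>4 = nc])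
  have MU: "M * U \<in> carrier_mat nr nc" using M U by simp
  have "(M * X)\<^sup>T = M * U * (M * U * E)\<^sup>T"
    unfolding MX using MU C by (subst transpose_mult[of _ nr nc _ nr]) auto
  also have "(M * U * E)\<^sup>T = E * (M * U)\<^sup>T"
    using MU C by (subst transpose_mult[of _ nr nc _ nc]) (auto simp: sym)
  also have "M * U * (E * (M * U)\<^sup>T) = M * X"
    unfolding MX using MU C by (intro assoc_mult_mat[of _ nr nc _ nc _ nr, symmetric]) auto
  finally have 4: "(M * X)\<^sup>T = M * X" .
  show ?thesis unfolding is_pseudoinverse_def using 1 2 3 4 X by (auto simp: nr_def nc_def)
qed

text \<open>Penrose's argument: the symmetric products \<open>M * X\<close> and \<open>M * Y\<close>
  coincide, and so do \<open>X * M\<close> and \<open>Y * M\<close>; then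
  \<open>X = X M X = Y M X = Y M Y = Y\<close>.\<close>

lemma is_pseudoinverse_unique:
  assumes "is_pseudoinverse M X" "is_pseudoinverse M Y"
  shows "X = Y"
proof -
  define nr nc where "nr = dim_row M" and "nc = dim_col M"
  have M: "M \<in> carrier_mat nr nc" by (simp add: nr_def nc_def)
  have X: "X \<in> carrier_mat nc nr" "M * X * M = M" "X * M * X = X" "(M * X)\<^sup>T = M * X" "(X * M)\<^sup>T = X * M"
    and Y: "Y \<in> carrier_mat nc nr" "M * Y * M = M" "Y * M * Y = Y" "(M * Y)\<^sup>T = M * Y" "(Y * M)\<^sup>T = Y * M"
    using assms unfolding is_pseudoinverse_def nr_def nc_def by auto
  have "M * X = (M * Y * M) * X" unfolding Y(2) ..
  also have "\<dots> = (M * Y) * (M * X)"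
    using M X(1) Y(1) by (intro assoc_mult_mat[of _ nr nr _ nc _ nr]) auto
  \<comment> \<open>Both factors are symmetric, so transposing swaps them and lets
    \<open>M * X * M\<close> collapse to \<open>M\<close>.\<close>
  also have "\<dots> = ((M * X) * (M * Y))\<^sup>T"
    using M X(1) Y(1) by (subst transpose_mult[of _ nr nr _ nr]) (auto simp: X Y)
  also have "(M * X) * (M * Y) = (M * X * M) * Y"
    using M X(1) Y(1) by (intro assoc_mult_mat[of _ nr nr _ nc _ nr, symmetric]) auto
  also have "(M * X * M * Y)\<^sup>T = M * Y" unfolding X(2) by (rule Y(4))
  finally have MX: "M * X = M * Y" .
  have "X * M = X * (M * Y * M)" unfolding Y(2) ..
  also have "\<dots> = X * (M * (Y * M))"
    using M Y(1) by (subst assoc_mult_mat[of _ nr nc _ nr _ nc]) auto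
  also have "\<dots> = (X * M) * (Y * M)"
    using M X(1) Y(1) by (intro assoc_mult_mat[of _ nc nr _ nc _ nc, symmetric]) auto
  also have "\<dots> = ((Y * M) * (X * M))\<^sup>T"
    using mult_carrier_mat[OF X(1) M] mult_carrier_mat[OF Y(1) M]
    by (subst transpose_mult[of _ nc nc _ nc]) (auto simp: X Y)
  also have "(Y * M) * (X * M) = Y * (M * (X * M))"
    using M X(1) Y(1) by (intro assoc_mult_mat[of _ nc nr _ nc _ nc]) auto
  also have "M * (X * M) = M * X * M"
    using M X(1) by (subst assoc_mult_mat[of _ nr nc _ nr _ nc]) auto
  also have "(Y * (M * X * M))\<^sup>T = Y * M" unfolding X(2) by (rule Y(5))
  finally have XM: "X * M = Y * M" .
  have "X = Y * M * X" using X(3) XM by simp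
  also have "\<dots> = Y * (M * X)"
    using M X(1) Y(1) by (intro assoc_mult_mat[of _ nc nr _ nc _ nr]) auto
  also have "\<dots> = Y * M * Y" unfolding MX
    using M X(1) Y(1) by (intro assoc_mult_mat[of _ nc nr _ nc _ nr, symmetric]) auto
  finally show ?thesis using Y(3) by simp
qed

lemma is_pseudoinverse_pseudoinverse: "is_pseudoinverse M (pseudoinverse M)"
  unfolding pseudoinverse_def
  using is_pseudoinverse_exists is_pseudoinverse_unique by (metis theI)

text \<open>\<open>M * X\<close> is symmetric and idempotent, hence an orthogonal projection.
  Expanding the nonnegative squared norm of \<open>y - P y\<close> shows that it does not increase
  lengths.\<close>

lemma vec_norm2_mult_pseudoinverse_le:
  assumes M: "M \<in> carrier_mat nr nc" and X: "is_pseudoinverse M X" and y: "y \<in> carrier_vec nr"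
  shows "vec_norm2 (M *\<^sub>v (X *\<^sub>v y)) \<le> vec_norm2 y"
proof -
  define P where "P = M * X"
  have Xc: "X \<in> carrier_mat nc nr" using M X by (auto simp: is_pseudoinverse_def)
  have P: "P \<in> carrier_mat nr nr" "P\<^sup>T = P" and PP: "P * P = P"
  proof -
    show "P \<in> carrier_mat nr nr" "P\<^sup>T = P"
      using M X Xc by (auto simp: P_def is_pseudoinverse_def)
    have "P * P = M * X * M * X"
      unfolding P_def using M Xc by (intro assoc_mult_mat[of _ nr nr _ nc _ nr, symmetric]) auto
    then show "P * P = P" using X by (simp add: P_def is_pseudoinverse_def)
  qed
  let ?p = "P *\<^sub>v y"
  have p: "?p \<in> carrier_vec nr" using P y by auto
  have pp: "?p \<bullet> ?p = y \<bullet> ?p"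
    using scalar_prod_mult_mat_vec_self[OF P(1) y] unfolding P(2) PP .
  have "0 \<le> (y - ?p) \<bullet> (y - ?p)" by (rule self_scalar_prod_ge_0)
  also have "\<dots> = y \<bullet> y - ?p \<bullet> ?p"
    using y p pp comm_scalar_prod[OF p y]
    by (simp add: minus_scalar_prod_distrib[of _ nr] scalar_prod_minus_distrib[of _ nr])
  finally show ?thesis
    using M Xc y by (simp add: vec_norm2_le_iff P_def)
qed

text \<open>\<open>A\<^sup>\<dagger> A\<close> is symmetric with \<open>A A\<^sup>\<dagger> A = A\<close>, so it fixes the range of \<open>A\<^sup>T\<close>.\<close>

lemma pseudoinverse_mult_row_space:
  assumes M: "M \<in> carrier_mat nr nc" and X: "is_pseudoinverse M X" and y: "y \<in> carrier_vec nr"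
  shows "X *\<^sub>v (M *\<^sub>v (M\<^sup>T *\<^sub>v y)) = M\<^sup>T *\<^sub>v y"
proof -
  have Xc: "X \<in> carrier_mat nc nr" and X1: "M * X * M = M" and X2: "(X * M)\<^sup>T = X * M"
    using M X by (auto simp: is_pseudoinverse_def)
  have XM: "X * M \<in> carrier_mat nc nc" using Xc M by simp
  have "M\<^sup>T = (M * (X * M))\<^sup>T"
    using X1 M Xc by (simp add: assoc_mult_mat[of _ nr nc _ nr _ nc])
  also have "\<dots> = (X * M) * M\<^sup>T"
    unfolding transpose_mult[OF M XM] X2 ..
  finally have "M\<^sup>T *\<^sub>v y = ((X * M) * M\<^sup>T) *\<^sub>v y" by simp
  also have "\<dots> = (X * M) *\<^sub>v (M\<^sup>T *\<^sub>v y)"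
    using XM M y by (intro assoc_mult_mat_vec) auto
  also have "\<dots> = X *\<^sub>v (M *\<^sub>v (M\<^sup>T *\<^sub>v y))"
    using Xc M y by (intro assoc_mult_mat_vec) auto
  finally show ?thesis by simp
qed

section \<open>Singular values\<close>

lemma proots_prod_linear_factors: "proots (\<Prod>a\<leftarrow>xs. [:- a, 1:]) = mset (xs :: real list)"
proof (induction xs)
  case (Cons a xs)
  have "(\<Prod>a\<leftarrow>xs. [:- a, 1:]) \<noteq> 0" by (auto simp: prod_list_zero_iff)
  then have "proots ([:- a, 1:] * (\<Prod>a\<leftarrow>xs. [:- a, 1:])) = {#a#} + mset xs"
    using Cons by (subst proots_mult) auto
  then show ?case by simp
qed simp

text \<open>Similarity to the diagonal matrix makes the \<open>d i\<close>, with multiplicity, the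
  roots of the characteristic polynomial. Since \<open>sort\<close> is ascending and counts from 0,
  the \<open>r\<close>th largest sits at position \<open>nc - r\<close>.\<close>

lemma singular_value_eq:
  assumes M: "M \<in> carrier_mat nr nc" and U: "U \<in> carrier_mat nc nc" "U\<^sup>T * U = 1\<^sub>m nc"
    and S: "M\<^sup>T * M = U * mat_diag nc d * U\<^sup>T" and r: "1 \<le> r" "r \<le> nc"
  shows "singular_value M r = sqrt (sort (map d [0..<nc]) ! (nc - r))"
proof -
  have "similar_mat (M\<^sup>T * M) (mat_diag nc d)"
    unfolding similar_mat_def
    using similar_mat_witI[OF orthogonal_mat_right_inverse[OF U] U(2) S] M U by auto
  then have "char_poly (M\<^sup>T * M) = char_poly (mat_diag nc d)" by (rule char_poly_similar)
  also have "\<dots> = (\<Prod>a\<leftarrow>diag_mat (mat_diag nc d). [:- a, 1:])"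
    by (rule char_poly_upper_triangular[of _ nc]) (auto simp: mat_diag_def)
  also have "diag_mat (mat_diag nc d) = map d [0..<nc]"
    by (auto simp: diag_mat_def mat_diag_def)
  finally have "proots (char_poly (M\<^sup>T * M)) = mset (map d [0..<nc])"
    by (simp only: proots_prod_linear_factors)
  then have "singular_values M = rev (map sqrt (sort (map d [0..<nc])))"
    unfolding singular_values_def by (metis sorted_list_of_multiset_mset)
  then show ?thesis using r by (simp add: singular_value_def rev_nth)
qed

text \<open>Otherwise \<open>x\<close> would stand before position \<open>length xs - r\<close> in
  the sorted list. All entries from \<open>x\<close> on are positive, which would give more than
  \<open>r\<close> nonzero ones.\<close>

lemma nth_sort_le_nonzero:
  fixes xs :: "real list"
  assumes nonneg: "\<And>y. y \<in> set xs \<Longrightarrow> 0 \<le> y"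
    and count: "length (filter (\<lambda>y. y \<noteq> 0) xs) \<le> r"
    and x: "x \<in> set xs" "x \<noteq> 0"
  shows "sort xs ! (length xs - r) \<le> x"
proof (rule ccontr)
  assume less: "\<not> ?thesis"
  obtain j where j: "j < length xs" "sort xs ! j = x"
    using x(1) by (metis in_set_conv_nth length_sort set_sort)
  have jr: "j < length xs - r"
    using less j sorted_nth_mono[of "sort xs" "length xs - r" j] by fastforce
  have "x > 0" using nonneg x by force
  then have "{j..<length xs} \<subseteq> {i. i < length (sort xs) \<and> sort xs ! i \<noteq> 0}"
    using j sorted_nth_mono[of "sort xs" j] by fastforce
  then have "card {j..<length xs} \<le> card {i. i < length (sort xs) \<and> sort xs ! i \<noteq> 0}"
    by (intro card_mono) auto
  also have "\<dots> = length (filter (\<lambda>y. y \<noteq> 0) (sort xs))"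
    by (rule length_filter_conv_card[symmetric])
  also have "\<dots> = length (filter (\<lambda>y. y \<noteq> 0) xs)"
    by (metis filter_sort length_sort)
  finally show False using count jr by simp
qed

section \<open>Orthonormal columns, and the lower bound by the smallest nonzero singular
  value\<close>

lemma orthonormal_cols:
  fixes U :: "real mat"
  assumes U: "U \<in> carrier_mat n m" "U\<^sup>T * U = 1\<^sub>m m" and ij: "i < m" "j < m"
  shows "col U i \<bullet> col U j = (if i = j then 1 else 0)"
proof -
  have "col U i \<bullet> col U j = (U\<^sup>T * U) $$ (i,j)" using U(1) ij by simp
  then show ?thesis using U(2) ij by simp
qed

lemma orthonormal_mult_vec:
  fixes U :: "real mat"
  assumes U: "U \<in> carrier_mat n m" "U\<^sup>T * U = 1\<^sub>m m" and x: "x \<in> carrier_vec m"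
  shows "(U *\<^sub>v x) \<bullet> (U *\<^sub>v x) = x \<bullet> x"
  using scalar_prod_mult_mat_vec_self[OF U(1) x] U(2) x by simp

context vec_space
begin

text \<open>Appending the vectors of \<open>T\<close> to the columns of \<open>A\<close> leaves the
  span, and so the rank, unchanged, while the enlarged matrix has \<open>card T\<close> independent
  columns.\<close>

lemma card_le_rank:
  assumes A: "A \<in> carrier_mat n nc" and T: "finite T" "T \<subseteq> col_space A" "lin_indpt T"
  shows "card T \<le> rank A"
proof -
  obtain ts where ts: "set ts = T" using T(1) finite_list by blast
  have cA: "set (cols A) \<subseteq> carrier_vec n" using A cols_dim by blast
  have Tc: "T \<subseteq> carrier_vec n"
    using T(2) cA unfolding col_space_def by (meson span_closed subset_iff)
  let ?C = "mat_of_cols n (cols A @ ts)"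
  have colsC: "cols ?C = cols A @ ts"
    using cA Tc ts by (intro cols_mat_of_cols) auto
  have "span (set (cols A) \<union> T) = span (set (cols A))"
  proof
    show "span (set (cols A) \<union> T) \<subseteq> span (set (cols A))"
      using cA T(2) in_own_span[OF cA] unfolding col_space_def by (intro span_subsetI) auto
    show "span (set (cols A)) \<subseteq> span (set (cols A) \<union> T)"
      using span_is_monotone by simp
  qed
  then have "rank ?C = rank A" unfolding rank_def colsC using ts by simp
  moreover have "card T \<le> rank ?C"
    by (rule rank_ge_card_indpt[of _ "length (cols A @ ts)"]) (use T ts colsC in auto)
  ultimately show ?thesis by simp
qed

end

text \<open>\<open>U\<close> preserves lengths, so its kernel is trivial. Distinctness of the
  columns lets a dependence of the column set be read as a kernel vector.\<close>

lemma orthonormal_lin_indpt: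
  fixes U :: "real mat"
  assumes U: "U \<in> carrier_mat n m" "U\<^sup>T * U = 1\<^sub>m m"
  shows "module.lin_indpt class_ring (module_vec TYPE(real) n) (set (cols U))"
proof -
  interpret vec_space "TYPE(real)" n .
  have dist: "distinct (cols U)"
    unfolding distinct_conv_nth
  proof (intro allI impI)
    fix i j assume "i < length (cols U)" "j < length (cols U)" "i \<noteq> j"
    then show "cols U ! i \<noteq> cols U ! j"
      using U(1) orthonormal_cols[OF U, of i j] orthonormal_cols[OF U, of j j] by auto
  qed
  show ?thesis
  proof
    assume "lin_dep (set (cols U))"
    from lin_depE[OF U(1) this dist] obtain v
      where v: "v \<in> carrier_vec m" "v \<noteq> 0\<^sub>v m" "U *\<^sub>v v = 0\<^sub>v n" by blast
    then have "v \<bullet> v = 0" using orthonormal_mult_vec[OF U v(1)] by simp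
    then show False using v self_scalar_prod_eq_0_iff by blast
  qed
qed

text \<open>In the orthonormal eigenbasis of \<open>A\<^sup>T * A\<close>, the squared norm of
  \<open>A v\<close> is the sum of \<open>d i\<close> times the squared coordinates of
  \<open>v\<close>. Coordinates with \<open>d i = 0\<close> vanish because \<open>v\<close> lies in
  the row space, and every other \<open>d i\<close> is at least the entry \<open>s\<close>.\<close>

lemma singular_value_rank_le:
  fixes A :: "real mat"
  assumes A: "A \<in> carrier_mat n n"
    and range: "vec_space.col_space n A = vec_space.col_space n A\<^sup>T"
    and v: "v \<in> vec_space.col_space n A"
  shows "singular_value A (vec_space.rank n A) * vec_norm2 v \<le> vec_norm2 (A *\<^sub>v v)"
proof -
  interpret vec_space "TYPE(real)" n .
  define r where "r = rank A"
  have At: "A\<^sup>T \<in> carrier_mat n n" using A by simp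
  obtain y where y: "y \<in> carrier_vec n" "A\<^sup>T *\<^sub>v y = v"
    using v A unfolding range col_space_eq[OF At] by auto
  have vc: "v \<in> carrier_vec n" using y A by auto
  obtain U d where U: "U \<in> carrier_mat n n" "U\<^sup>T * U = 1\<^sub>m n"
    and S: "A\<^sup>T * A = U * mat_diag n d * U\<^sup>T"
    and eig: "\<And>i. i < n \<Longrightarrow> (A\<^sup>T * A) *\<^sub>v col U i = d i \<cdot>\<^sub>v col U i"
    and norm: "\<And>i. i < n \<Longrightarrow> (A *\<^sub>v col U i) \<bullet> (A *\<^sub>v col U i) = d i"
    using gram_diagonalization[OF A] by metis
  have colc: "col U i \<in> carrier_vec n" for i using U by auto
  define c where "c = U\<^sup>T *\<^sub>v v"
  have c: "c \<in> carrier_vec n" using U vc by (auto simp: c_def)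
  have ci: "c $ i = col U i \<bullet> v" if "i < n" for i using that U by (simp add: c_def)
  have vv: "v \<bullet> v = (\<Sum>i<n. c $ i * c $ i)"
    using orthonormal_mult_vec[of "U\<^sup>T" n n v] U vc orthogonal_mat_right_inverse[OF U] c
    by (simp add: c_def[symmetric] scalar_prod_def lessThan_atLeast0)
  have "(A *\<^sub>v v) \<bullet> (A *\<^sub>v v) = v \<bullet> (U *\<^sub>v (mat_diag n d *\<^sub>v c))"
  proof -
    obtain D where D: "D = mat_diag n d" "D \<in> carrier_mat n n" by simp
    have "(U * D * U\<^sup>T) *\<^sub>v v = (U * D) *\<^sub>v (U\<^sup>T *\<^sub>v v)"
      using U D(2) vc by (intro assoc_mult_mat_vec[of _ n n _ n]) auto
    also have "\<dots> = U *\<^sub>v (D *\<^sub>v c)"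
      using U D(2) vc unfolding c_def by (intro assoc_mult_mat_vec[of _ n n _ n]) auto
    finally show ?thesis using scalar_prod_mult_mat_vec_self[OF A vc] unfolding S D by simp
  qed
  also have "\<dots> = c \<bullet> (mat_diag n d *\<^sub>v c)"
    using transpose_vec_mult_scalar[OF U(1) _ vc, of "mat_diag n d *\<^sub>v c"] c
      mult_mat_vec_carrier[OF mat_diag_dim c, of d] by (simp add: c_def)
  also have "mat_diag n d *\<^sub>v c = vec n (\<lambda>i. d i * c $ i)"
    using c by (intro eq_vecI) (auto simp: mat_diag_def scalar_prod_def if_distrib[of "\<lambda>x. x * _"] cong: if_cong)
  also have "c \<bullet> vec n (\<lambda>i. d i * c $ i) = (\<Sum>i<n. d i * (c $ i * c $ i))"
    by (auto simp: scalar_prod_def lessThan_atLeast0 mult_ac)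
  finally have AvAv: "(A *\<^sub>v v) \<bullet> (A *\<^sub>v v) = (\<Sum>i<n. d i * (c $ i * c $ i))" .
  \<comment> \<open>Here \<open>col U i\<close> lies in the kernel of \<open>A\<close>, which is
    orthogonal to \<open>v = A\<^sup>T y\<close>.\<close>
  have c0: "c $ i = 0" if i: "i < n" "d i = 0" for i
  proof -
    have "A *\<^sub>v col U i = 0\<^sub>v n"
      using norm[OF i(1)] i(2) self_scalar_prod_eq_0_iff[of "A *\<^sub>v col U i" n]
        mult_mat_vec_carrier[OF A colc] by simp
    then have "col U i \<bullet> (A\<^sup>T *\<^sub>v y) = 0"
      using scalar_prod_mult_mat_vec[OF A colc[of i] y(1)] y(1) by simp
    then show ?thesis using ci[OF i(1)] y(2) by simp
  qed
  have d_nonneg: "d i \<ge> 0" if "i < n" for i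
    using norm[OF that] self_scalar_prod_ge_0 by metis
  define I where "I = {i. i < n \<and> d i \<noteq> 0}"
  have "card I \<le> r"
  proof -
    have inj: "inj_on (col U) I"
    proof (rule inj_onI)
      fix i j assume "i \<in> I" "j \<in> I" "col U i = col U j"
      then show "i = j"
        using orthonormal_cols[OF U, of i j] orthonormal_cols[OF U, of j j]
        by (auto simp: I_def split: if_splits)
    qed
    \<comment> \<open>Dividing the eigenvalue equation by \<open>d i\<close> exhibits the
      eigenvector as an element of the range of \<open>A\<^sup>T\<close>, which equals that of
      \<open>A\<close>.\<close>
    have "col U i \<in> col_space A" if "i \<in> I" for i
    proof -
      have i: "i < n" "d i \<noteq> 0" using that by (auto simp: I_def)
      have "A\<^sup>T *\<^sub>v ((1 / d i) \<cdot>\<^sub>v (A *\<^sub>v col U i)) = (1 / d i) \<cdot>\<^sub>v ((A\<^sup>T * A) *\<^sub>v col U i)"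
        using At A colc[of i] mult_mat_vec[OF At mult_mat_vec_carrier[OF A colc[of i]]] by simp
      also have "\<dots> = col U i" unfolding eig[OF i(1)] using i by (simp add: smult_smult_assoc)
      finally have "A\<^sup>T *\<^sub>v ((1 / d i) \<cdot>\<^sub>v (A *\<^sub>v col U i)) = col U i" .
      moreover have "(1 / d i) \<cdot>\<^sub>v (A *\<^sub>v col U i) \<in> carrier_vec n"
        using A colc[of i] by auto
      ultimately show ?thesis
        unfolding range col_space_eq[OF At] using A colc[of i] by auto
    qed
    moreover have "lin_indpt (col U ` I)"
      using U(1) by (intro subset_li_is_li[OF orthonormal_lin_indpt[OF U]])
        (auto simp: I_def cols_def)
    ultimately have "card (col U ` I) \<le> r"
      unfolding r_def by (intro card_le_rank[OF A]) (auto simp: I_def)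
    then show ?thesis using card_image[OF inj] by simp
  qed
  then have count: "length (filter (\<lambda>y. y \<noteq> 0) (map d [0..<n])) \<le> r"
    unfolding length_filter_conv_card I_def by (auto cong: conj_cong)
  \<comment> \<open>For \<open>1 \<le> r\<close> this is the square of the \<open>r\<close>th
    singular value.\<close>
  define s where "s = sort (map d [0..<n]) ! (n - r)"
  have s_le: "s \<le> d i" if "i < n" "d i \<noteq> 0" for i
  proof -
    have "sort (map d [0..<n]) ! (length (map d [0..<n]) - r) \<le> d i"
      by (rule nth_sort_le_nonzero[OF _ count]) (use d_nonneg that in auto)
    then show ?thesis by (simp add: s_def)
  qed
  show ?thesis
  \<comment> \<open>With no nonzero \<open>d i\<close> the vector \<open>v\<close> is zero, so the
    claim holds whatever \<open>singular_value A r\<close> is. Otherwise \<open>r\<close> is at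
    least 1 and a valid index.\<close>
  proof (cases "I = {}")
    case True
    then have "v \<bullet> v = 0" unfolding vv using c0 by (auto simp: I_def)
    then show ?thesis by (simp add: vec_norm2_def self_scalar_prod_ge_0)
  next
    case False
    have "card I > 0" using False by (auto simp: I_def card_gt_0_iff)
    then have r: "1 \<le> r" "r \<le> n" using \<open>card I \<le> r\<close> rank_le_nc[OF A] by (auto simp: r_def)
    have "s * (v \<bullet> v) \<le> (A *\<^sub>v v) \<bullet> (A *\<^sub>v v)"
      unfolding vv AvAv sum_distrib_left
    proof (rule sum_mono)
      fix i assume i: "i \<in> {..<n}"
      show "s * (c $ i * c $ i) \<le> d i * (c $ i * c $ i)"
        using i c0[of i] s_le[of i] by (cases "d i = 0") (auto intro: mult_right_mono)
    qed
    moreover have "singular_value A r = sqrt s"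
      unfolding s_def by (rule singular_value_eq[OF A U S r])
    ultimately show ?thesis
      unfolding vec_norm2_def r_def[symmetric]
      by (metis real_sqrt_le_iff real_sqrt_mult)
  qed
qed

text \<open>The last of the \<open>k\<close> singular values is the smallest, at sorted position
  \<open>k - k = 0\<close>; a unit eigenvector of \<open>H\<^sup>T * H\<close> for its square serves
  as \<open>w\<close>.\<close>

lemma singular_value_dim_col_attained:
  fixes H :: "real mat"
  assumes H: "H \<in> carrier_mat nr k" and k: "k \<ge> 1"
  obtains w where "w \<in> carrier_vec k" "vec_norm2 w = 1" "singular_value H k = vec_norm2 (H *\<^sub>v w)"
proof -
  obtain U d where U: "U \<in> carrier_mat k k" "U\<^sup>T * U = 1\<^sub>m k"
    and S: "H\<^sup>T * H = U * mat_diag k d * U\<^sup>T"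
    and norm: "\<And>i. i < k \<Longrightarrow> (H *\<^sub>v col U i) \<bullet> (H *\<^sub>v col U i) = d i"
    using gram_diagonalization[OF H] by metis
  have "sort (map d [0..<k]) ! 0 \<in> set (sort (map d [0..<k]))"
    using k by (intro nth_mem) simp
  then obtain i where i: "i < k" "sort (map d [0..<k]) ! 0 = d i" by auto
  have "singular_value H k = sqrt (d i)"
    using singular_value_eq[OF H U S k] i by simp
  then show thesis
    using that[of "col U i"] norm[OF i(1)] orthonormal_cols[OF U i(1) i(1)] col_carrier_vec[OF i(1) U(1)]
    by (simp add: vec_norm2_def)
qed

section \<open>The Arnoldi decomposition\<close>

text \<open>\<open>H w\<close> holds the coordinates of \<open>A Q w\<close> in an orthonormal
  basis. In the breakdown case only the first \<open>k\<close> coordinates occur, and the zero last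
  row of \<open>H\<close> adds nothing to the norm.\<close>

lemma arnoldi_decomposition_norm:
  assumes A: "A \<in> carrier_mat n n" and dec: "arnoldi_decomposition n A v k Q H"
    and w: "w \<in> carrier_vec k"
  shows "vec_norm2 (A *\<^sub>v (Q *\<^sub>v w)) = vec_norm2 (H *\<^sub>v w)"
proof -
  have Q: "Q \<in> carrier_mat n k" "Q\<^sup>T * Q = 1\<^sub>m k" and H: "H \<in> carrier_mat (k + 1) k"
    using dec by (auto simp: arnoldi_decomposition_def arnoldi_basis_def)
  have AQ: "A *\<^sub>v (Q *\<^sub>v w) = (A * Q) *\<^sub>v w" using A Q w by simp
  show ?thesis
  proof (cases "vec_space.krylov_dim n A v (k + 1) = k + 1")
    case True
    then obtain q where ar: "arnoldi_basis n A v (k + 1) (mat_of_cols n (cols Q @ [q]))"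
      and AQ': "A * Q = mat_of_cols n (cols Q @ [q]) * H"
      using dec by (auto simp: arnoldi_decomposition_def)
    define Q' where "Q' = mat_of_cols n (cols Q @ [q])"
    have Q': "Q' \<in> carrier_mat n (k + 1)" "Q'\<^sup>T * Q' = 1\<^sub>m (k + 1)"
      using ar by (auto simp: arnoldi_basis_def Q'_def)
    have "(A * Q) *\<^sub>v w = Q' *\<^sub>v (H *\<^sub>v w)"
      unfolding AQ' Q'_def[symmetric] using Q'(1) H w by (rule assoc_mult_mat_vec)
    then show ?thesis
      using orthonormal_mult_vec[OF Q' mult_mat_vec_carrier[OF H w]]
      by (simp add: AQ vec_norm2_def)
  next
    case False
    define H' where "H' = mat k k (\<lambda>(i, j). H $$ (i, j))"
    have row: "row H k = 0\<^sub>v k" and AQ': "A * Q = Q * H'"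
      using dec False by (auto simp: arnoldi_decomposition_def H'_def)
    have H': "H' \<in> carrier_mat k k" by (simp add: H'_def)
    have "(A * Q) *\<^sub>v w = Q *\<^sub>v (H' *\<^sub>v w)"
      unfolding AQ' using Q(1) H' w by (rule assoc_mult_mat_vec)
    moreover have "(H *\<^sub>v w) \<bullet> (H *\<^sub>v w) = (H' *\<^sub>v w) \<bullet> (H' *\<^sub>v w)"
    proof -
      have "(H *\<^sub>v w) $ i = (H' *\<^sub>v w) $ i" if "i < k" for i
      proof -
        have "row H i = row H' i" using H that by (intro eq_vecI) (auto simp: H'_def)
        then show ?thesis using that H H' by simp
      qed
      moreover have "(H *\<^sub>v w) $ k = 0" using H row w by simp
      ultimately show ?thesis using H H' by (simp add: scalar_prod_def)
    qed
    ultimately show ?thesis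
      using orthonormal_mult_vec[OF Q mult_mat_vec_carrier[OF H' w]]
      by (simp add: AQ vec_norm2_def)
  qed
qed

text \<open>The starting vector already carries a factor \<open>A\<close>, and powers of
  \<open>A\<close> commute with \<open>A\<close>, so every generator can be written as
  \<open>A\<close> applied to some vector.\<close>

lemma (in vec_space) krylov_subset_col_space:
  assumes A: "A \<in> carrier_mat n n" and r0: "r0 \<in> carrier_vec n"
  shows "krylov A (A *\<^sub>v r0) k \<subseteq> col_space A"
proof -
  have cA: "set (cols A) \<subseteq> carrier_vec n" using A cols_dim by blast
  have "(A ^\<^sub>m i) *\<^sub>v (A *\<^sub>v r0) \<in> col_space A" for i
  proof -
    have "(A ^\<^sub>m i) *\<^sub>v (A *\<^sub>v r0) = (A ^\<^sub>m Suc i) *\<^sub>v r0"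
      using assoc_mult_mat_vec[OF pow_carrier_mat[OF A] A r0, of i] by simp
    also have "A ^\<^sub>m Suc i = A * A ^\<^sub>m i"
      by (induction i) (use A in \<open>simp_all add: assoc_mult_mat[where ?n\<^sub>1 = n and ?n\<^sub>2 = n and ?n\<^sub>3 = n and ?n\<^sub>4 = n]\<close>)
    also have "(A * A ^\<^sub>m i) *\<^sub>v r0 = A *\<^sub>v ((A ^\<^sub>m i) *\<^sub>v r0)"
      using assoc_mult_mat_vec[OF A pow_carrier_mat[OF A] r0, of i] by simp
    finally have "(A ^\<^sub>m i) *\<^sub>v (A *\<^sub>v r0) = A *\<^sub>v ((A ^\<^sub>m i) *\<^sub>v r0)" .
    moreover have "(A ^\<^sub>m i) *\<^sub>v r0 \<in> carrier_vec n"
      by (rule mult_mat_vec_carrier[OF pow_carrier_mat[OF A] r0])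
    ultimately show ?thesis unfolding col_space_eq[OF A] using A by auto
  qed
  then show ?thesis
    unfolding krylov_def col_space_def by (intro span_subsetI[OF cA]) auto
qed

section \<open>Transfer of both bounds from the matrix to its extended Hessenberg matrix\<close>

theorem mainTheorem5:
  fixes A H :: "real mat" and b x0 r0 :: "real vec" and n r k :: nat
  assumes "A \<in> carrier_mat n n"
    and "A \<noteq> 0\<^sub>m n n"
    and "vec_space.rank n A = r"
    and "vec_space.col_space n A = vec_space.col_space n A\<^sup>T"
    and "b \<in> carrier_vec n"
    and "x0 \<in> carrier_vec n"
    and "r0 = b - A *\<^sub>v x0"
    and "k \<ge> 1"
    and "vec_space.krylov_dim n A (A *\<^sub>v r0) k = k"
    and "rrgmres_hessenberg n A r0 k H"
  shows "singular_value H k \<ge> singular_value A r \<and>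
         condition_number H \<le> condition_number A"
proof -
  interpret vec_space "TYPE(real)" n .
  note A = assms(1) and range = assms(4)
  have r0: "r0 \<in> carrier_vec n" using assms by auto
  obtain Q where dec: "arnoldi_decomposition n A (A *\<^sub>v r0) k Q H"
    using assms(10) by (auto simp: rrgmres_hessenberg_def)
  then have Q: "Q \<in> carrier_mat n k" "Q\<^sup>T * Q = 1\<^sub>m k" and H: "H \<in> carrier_mat (k + 1) k"
    and span: "span (col Q ` {..<k}) = krylov A (A *\<^sub>v r0) k"
    by (auto simp: arnoldi_decomposition_def arnoldi_basis_def)
  note AQ = arnoldi_decomposition_norm[OF A dec]
  have normQ: "vec_norm2 (Q *\<^sub>v w) = vec_norm2 w" if "w \<in> carrier_vec k" for w
    using orthonormal_mult_vec[OF Q that] by (simp add: vec_norm2_def)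
  have Qw: "Q *\<^sub>v w \<in> col_space A" if "w \<in> carrier_vec k" for w
  proof -
    have "Q *\<^sub>v w \<in> col_space Q"
      unfolding col_space_eq[OF Q(1)] using Q(1) that by auto
    also have "col_space Q = span (col Q ` {..<k})"
      using Q(1) by (simp add: col_space_def cols_def lessThan_atLeast0)
    finally show ?thesis
      unfolding span using krylov_subset_col_space[OF A r0] by blast
  qed
  obtain w where w: "w \<in> carrier_vec k" "vec_norm2 w = 1"
      "singular_value H k = vec_norm2 (H *\<^sub>v w)"
    using singular_value_dim_col_attained[OF H assms(8)] by blast
  \<comment> \<open>Since \<open>Q w\<close> is a unit vector in the range of \<open>A\<close>, the
    lower bound applies to the norm of \<open>A Q w\<close>, which is that of
    \<open>H w\<close>.\<close>
  have "singular_value A r \<le> singular_value H k"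
    using singular_value_rank_le[OF A range Qw[OF w(1)]] normQ[OF w(1)] AQ[OF w(1)] w assms(3)
    by simp
  moreover have "condition_number H \<le> condition_number A"
    unfolding condition_number_def
  \<comment> \<open>The two factors of the condition number are compared separately.\<close>
  proof (rule mult_mono)
    show "mat_norm2 H \<le> mat_norm2 A"
    proof (rule mat_norm2_leI[OF H mat_norm2_ge_0])
      fix x :: "real vec" assume x: "x \<in> carrier_vec k"
      show "vec_norm2 (H *\<^sub>v x) \<le> mat_norm2 A * vec_norm2 x"
        using vec_norm2_mult_le[OF A mult_mat_vec_carrier[OF Q(1) x]] AQ[OF x] normQ[OF x] by simp
    qed
    let ?A' = "pseudoinverse A" and ?H' = "pseudoinverse H"
    note piA = is_pseudoinverse_pseudoinverse[of A] and piH = is_pseudoinverse_pseudoinverse[of H]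
    have A': "?A' \<in> carrier_mat n n" and H': "?H' \<in> carrier_mat k (k + 1)"
      using piA piH A H by (auto simp: is_pseudoinverse_def)
    show "mat_norm2 ?H' \<le> mat_norm2 ?A'"
    proof (rule mat_norm2_leI[OF H' mat_norm2_ge_0])
      fix y :: "real vec" assume y: "y \<in> carrier_vec (k + 1)"
      let ?w = "?H' *\<^sub>v y"
      have w: "?w \<in> carrier_vec k" using H' y by auto
      have At: "A\<^sup>T \<in> carrier_mat n n" using A by simp
      \<comment> \<open>The equality of the two ranges puts \<open>Q ?w\<close> into the row space
        of \<open>A\<close>, where the pseudoinverse undoes \<open>A\<close>.\<close>
      obtain z where z: "z \<in> carrier_vec n" "A\<^sup>T *\<^sub>v z = Q *\<^sub>v ?w"
        using Qw[OF w] A unfolding range col_space_eq[OF At] by auto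
      have "vec_norm2 ?w = vec_norm2 (?A' *\<^sub>v (A *\<^sub>v (Q *\<^sub>v ?w)))"
        using pseudoinverse_mult_row_space[OF A piA z(1)] z(2) normQ[OF w] by simp
      also have "\<dots> \<le> mat_norm2 ?A' * vec_norm2 (A *\<^sub>v (Q *\<^sub>v ?w))"
        using A' A Q(1) w by (intro vec_norm2_mult_le) auto
      \<comment> \<open>The left side is the norm of \<open>H ?w\<close>, the orthogonal projection
        of \<open>y\<close> onto the range of \<open>H\<close>.\<close>
      also have "vec_norm2 (A *\<^sub>v (Q *\<^sub>v ?w)) \<le> vec_norm2 y"
        unfolding AQ[OF w] by (rule vec_norm2_mult_pseudoinverse_le[OF H piH y])
      finally show "vec_norm2 ?w \<le> mat_norm2 ?A' * vec_norm2 y"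
        by (simp add: mat_norm2_ge_0 mult_left_mono)
    qed
  qed (rule mat_norm2_ge_0)+
  ultimately show ?thesis by simp
qed

end
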